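(* Let $f:X\to X$ be a topologically transitive and topologically $GH$-stable homeomorphism of a nonempty compact metric space $X$. Then for every $\delta>0$ there exist a compact metric space $Y_\delta$ and a homeomorphism $g_\delta:Y_\delta\to Y_\delta$ such that \[ d_{GH^0}(f,g_\delta)<\delta \qquad\text{and}\qquad h_{\mathrm{top}}(g_\delta)=0 . \]
   Context: A homeomorphism $f:X\to X$ of a compact metric space is topologically transitive if there is a point $x\in X$ whose positive orbit $\{x,f(x),f^2(x),\dots\}$ is dense in $X$. Hausdorff distance: for nonempty subsets $A,B$ of a metric space $(X,d)$, $d_H(A,B)=\max\{\sup_{a\in A}\inf_{b\in B}d(a,b),\ \sup_{b\in B}\inf_{a\in A}d(a,b)\}$. $\Delta$-isometry: for compact metric spaces $(X,d^X)$, $(Y,d^Y)$ and $\Delta>0$, a map (not necessarily continuous) $i:X\to Y$ is a $\Delta$-isometry if $\max\{d_H(i(X),Y),\ \sup_{x,x'\in X}|d^Y(i(x),i(x'))-d^X(x,x')|\}<\Delta$. Uniform distance: for (not necessarily continuous) maps $u,v:Z\to W$ between metric spaces, $d_{C^0}(u,v)=\sup_{z\in Z}d^W(u(z),v(z))$. $C^0$-Gromov--Hausdorff distance: for continuous maps $f:X\to X$ and $g:Y\to Y$ of compact metric spaces, $d_{GH^0}(f,g)$ is the infimum of all $\Delta>0$ for which there exist $\Delta$-isometries $i:X\to Y$ and $j:Y\to X$ such that $d_{C^0}(g\circ i,i\circ f)<\Delta$ and $d_{C^0}(j\circ g,f\circ j)<\Delta$. Topological $GH$-stability: a homeomorphism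 $f:X\to X$ of a compact metric space is topologically $GH$-stable if for every $\varepsilon>0$ there exists $\eta>0$ such that for every homeomorphism $g:Y\to Y$ of a compact metric space with $d_{GH^0}(f,g)<\eta$ there exists a continuous $\varepsilon$-isometry $h:Y\to X$ with $f\circ h=h\circ g$. Topological entropy: for a continuous map $f:X\to X$ of a compact metric space $(X,d)$, a finite set $E\subset X$ is $(n,\delta)$-separated if $\max_{0\le j\le n-1}d(f^j(x),f^j(y))\ge\delta$ for all distinct $x,y\in E$; $s_n(f,\delta)$ is the supremum of the cardinalities of $(n,\delta)$-separated sets; and $h_{\mathrm{top}}(f)=\lim_{\delta\to0}\limsup_{n\to\infty}\frac1n\log s_n(f,\delta)$. *)

theory Defs
  imports "HOL-Analysis.Analysis"
begin

section \<open>Definitions\<close>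

definition topologically_transitive :: "'a metric \<Rightarrow> ('a \<Rightarrow> 'a) \<Rightarrow> bool" where
  "topologically_transitive X f \<longleftrightarrow>
     (\<exists>x \<in> mspace X. mtopology_of X closure_of (range (\<lambda>n. (f ^^ n) x)) = mspace X)"

text \<open>Suprema and infima of distances are taken in \<^typ>\<open>ennreal\<close>, where they always exist, with
  the supremum of the empty set being 0 and its infimum being infinite.\<close>

definition hausdorff_dist :: "'a metric \<Rightarrow> 'a set \<Rightarrow> 'a set \<Rightarrow> ennreal" where
  "hausdorff_dist X A B =
     max (SUP a\<in>A. INF b\<in>B. ennreal (mdist X a b)) (SUP b\<in>B. INF a\<in>A. ennreal (mdist X a b))"

definition delta_isometry :: "'a metric \<Rightarrow> 'b metric \<Rightarrow> real \<Rightarrow> ('a \<Rightarrow> 'b) \<Rightarrow> bool" where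
  "delta_isometry X Y \<Delta> i \<longleftrightarrow>
     i \<in> mspace X \<rightarrow> mspace Y \<and>
     max (hausdorff_dist Y (i ` mspace X) (mspace Y))
         (SUP x\<in>mspace X. SUP x'\<in>mspace X. ennreal \<bar>mdist Y (i x) (i x') - mdist X x x'\<bar>)
       < ennreal \<Delta>"

definition C0_dist :: "'a set \<Rightarrow> 'b metric \<Rightarrow> ('a \<Rightarrow> 'b) \<Rightarrow> ('a \<Rightarrow> 'b) \<Rightarrow> ennreal" where
  "C0_dist Z W u v = (SUP z\<in>Z. ennreal (mdist W (u z) (v z)))"

text \<open>If exactly one of the two spaces is empty, the infimum is over the empty set and the distance
  is infinite.\<close>

definition GH0_dist :: "'a metric \<Rightarrow> ('a \<Rightarrow> 'a) \<Rightarrow> 'b metric \<Rightarrow> ('b \<Rightarrow> 'b) \<Rightarrow> ennreal" where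
  "GH0_dist X f Y g = Inf {ennreal \<Delta> | \<Delta>. \<Delta> > 0 \<and>
     (\<exists>i j. delta_isometry X Y \<Delta> i \<and> delta_isometry Y X \<Delta> j \<and>
        C0_dist (mspace X) Y (g \<circ> i) (i \<circ> f) < ennreal \<Delta> \<and>
        C0_dist (mspace Y) X (j \<circ> g) (f \<circ> j) < ennreal \<Delta>)}"

text \<open>A formula cannot quantify over the type of points of \<open>Y\<close>. The compact metric spaces whose
  points are real numbers (with an arbitrary metric, unrelated to that of the real line) are used to
  represent all of them: every compact metric space is isometric to one of these
  (\<open>compact_metric_isometric_real\<close>), and the stability property then holds for spaces \<open>Y\<close>
  over any type (\<open>topologically_GH_stable_any_type\<close>).\<close>

definition topologically_GH_stable :: "'a metric \<Rightarrow> ('a \<Rightarrow> 'a) \<Rightarrow> bool" where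
  "topologically_GH_stable X f \<longleftrightarrow>
     (\<forall>\<epsilon>>0. \<exists>\<eta>>0. \<forall>(Y :: real metric) g.
        compact_space (mtopology_of Y) \<longrightarrow>
        homeomorphic_map (mtopology_of Y) (mtopology_of Y) g \<longrightarrow>
        GH0_dist X f Y g < ennreal \<eta> \<longrightarrow>
        (\<exists>h. continuous_map (mtopology_of Y) (mtopology_of X) h \<and>
             delta_isometry Y X \<epsilon> h \<and>
             (\<forall>y\<in>mspace Y. f (h y) = h (g y))))"

definition separated_set :: "'a metric \<Rightarrow> ('a \<Rightarrow> 'a) \<Rightarrow> nat \<Rightarrow> real \<Rightarrow> 'a set \<Rightarrow> bool" where
  "separated_set X f n \<delta> E \<longleftrightarrow> finite E \<and> E \<subseteq> mspace X \<and>
     (\<forall>x\<in>E. \<forall>y\<in>E. x \<noteq> y \<longrightarrow> (MAX j\<in>{..<n}. mdist X ((f ^^ j) x) ((f ^^ j) y)) \<ge> \<delta>)"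

text \<open>For a continuous map of a compact metric space, \<open>n > 0\<close> and \<open>\<delta> > 0\<close> the supremum is over a
  bounded set of natural numbers (\<open>bdd_above_card_separated\<close>). The case \<open>n = 0\<close> does not
  matter for the upper limit below.\<close>

definition max_separated :: "'a metric \<Rightarrow> ('a \<Rightarrow> 'a) \<Rightarrow> nat \<Rightarrow> real \<Rightarrow> nat" where
  "max_separated X f n \<delta> = (SUP E\<in>{E. separated_set X f n \<delta> E}. card E)"

definition topological_entropy :: "'a metric \<Rightarrow> ('a \<Rightarrow> 'a) \<Rightarrow> ereal" where
  "topological_entropy X f =
     Lim (at_right 0) (\<lambda>\<delta>. limsup (\<lambda>n. ereal (1 / real n * ln (real (max_separated X f n \<delta>)))))"

section \<open>Every compact metric space has an isometric copy over the reals\<close>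

lemma compact_metric_inj_real:
  fixes X :: "'a metric"
  assumes "compact_space (mtopology_of X)"
  shows "\<exists>\<phi> :: 'a \<Rightarrow> real. inj_on \<phi> (mspace X)"
proof -
  interpret M: Metric_space "mspace X" "mdist X" by auto
  have "M.mtotally_bounded (mspace X)"
    using assms M.compact_space_eq_mcomplete_mtotally_bounded by (simp add: mtopology_of_def)
  then have "\<forall>n::nat. \<exists>K. finite K \<and> K \<subseteq> mspace X \<and> mspace X \<subseteq> (\<Union>x\<in>K. M.mball x (1 / Suc n))"
    unfolding M.mtotally_bounded_def by simp
  then obtain K where K: "\<And>n::nat. finite (K n)" "\<And>n. K n \<subseteq> mspace X"
      "\<And>n. mspace X \<subseteq> (\<Union>x\<in>K n. M.mball x (1 / Suc n))"
    by metis
  define Q where "Q = (\<Union>n. K n) \<times> (UNIV :: nat set)"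
  have cQ: "countable Q"
    unfolding Q_def using K(1) by (intro countable_SIGMA countable_UN) (auto intro: countable_finite)
  define S where "S x = {(q, k) \<in> Q. mdist X q x < 1 / Suc k}" for x
  have inj: "inj_on S (mspace X)"
  proof (rule inj_onI, rule ccontr)
    fix x y assume xy: "x \<in> mspace X" "y \<in> mspace X" "S x = S y" "x \<noteq> y"
    then have "0 < mdist X x y / 2" by simp
    then obtain n where n: "1 / Suc n < mdist X x y / 2"
      using nat_approx_posE by blast
    obtain q where q: "q \<in> K n" "mdist X q x < 1 / Suc n"
      using K(3)[of n] xy(1) by auto
    then have "(q, n) \<in> S x" by (auto simp: S_def Q_def)
    then have "mdist X q y < 1 / Suc n" using xy by (auto simp: S_def)
    moreover have "mdist X x y \<le> mdist X q x + mdist X q y"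
      using M.triangle[of x q y] q K(2)[of n] xy M.commute[of x q] by auto
    ultimately show False using q n by linarith
  qed
  obtain \<psi> :: "nat set \<Rightarrow> real" where \<psi>: "inj \<psi>"
    using nat_sets_eqpoll_reals unfolding eqpoll_def bij_betw_def by blast
  have "inj_on (\<lambda>A. to_nat_on Q ` A) (Pow Q)"
    using cQ by (meson inj_on_image_Pow inj_on_to_nat_on)
  then have "inj_on (\<lambda>x. \<psi> (to_nat_on Q ` S x)) (mspace X)"
    using inj \<psi> unfolding inj_on_def S_def by (simp add: Collect_mono_iff Pow_def subset_iff)
  then show ?thesis by blast
qed

lemma compact_metric_isometric_real:
  fixes X :: "'a metric"
  assumes "compact_space (mtopology_of X)"
  obtains X' :: "real metric" and \<phi> :: "'a \<Rightarrow> real" where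
    "homeomorphic_map (mtopology_of X) (mtopology_of X') \<phi>"
    "bij_betw \<phi> (mspace X) (mspace X')"
    "\<And>x y. \<lbrakk>x \<in> mspace X; y \<in> mspace X\<rbrakk> \<Longrightarrow> mdist X' (\<phi> x) (\<phi> y) = mdist X x y"
proof -
  obtain \<phi> :: "'a \<Rightarrow> real" where \<phi>: "inj_on \<phi> (mspace X)"
    using compact_metric_inj_real[OF assms] by blast
  define \<theta> where "\<theta> = the_inv_into (mspace X) \<phi>"
  have \<theta>: "\<And>x. x \<in> mspace X \<Longrightarrow> \<theta> (\<phi> x) = x"
    using \<phi> by (simp add: \<theta>_def the_inv_into_f_f)
  define d where "d a b = mdist X (\<theta> a) (\<theta> b)" for a b
  interpret N: Metric_space "\<phi> ` mspace X" d
    by standard (auto simp: d_def \<theta> mdist_commute mdist_triangle)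
  interpret MN: Metric_space12 "mspace X" "mdist X" "\<phi> ` mspace X" d
    by (simp add: Metric_space12_def N.Metric_space_axioms)
  show thesis
  proof
    have "homeomorphic_map (Metric_space.mtopology (mspace X) (mdist X)) N.mtopology \<phi>"
      by (rule MN.isometry_imp_homeomorphic_map) (auto simp: d_def \<theta>)
    then show "homeomorphic_map (mtopology_of X) (mtopology_of (metric (\<phi> ` mspace X, d))) \<phi>"
      unfolding N.mtopology_of unfolding mtopology_of_def .
    show "bij_betw \<phi> (mspace X) (mspace (metric (\<phi> ` mspace X, d)))"
      using \<phi> by (simp add: bij_betw_def)
    show "mdist (metric (\<phi> ` mspace X, d)) (\<phi> x) (\<phi> y) = mdist X x y"
      if "x \<in> mspace X" "y \<in> mspace X" for x y
      using that by (simp add: d_def \<theta>)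
  qed
qed

lemma delta_isometry_isometry_left:
  assumes b: "bij_betw \<phi> (mspace Y) (mspace Y')"
    and d: "\<And>x y. \<lbrakk>x \<in> mspace Y; y \<in> mspace Y\<rbrakk> \<Longrightarrow> mdist Y' (\<phi> x) (\<phi> y) = mdist Y x y"
  shows "delta_isometry Y' X \<Delta> j \<longleftrightarrow> delta_isometry Y X \<Delta> (j \<circ> \<phi>)"
proof -
  have Y': "mspace Y' = \<phi> ` mspace Y" using b by (simp add: bij_betw_def)
  show ?thesis
    unfolding delta_isometry_def Y' image_image image_comp comp_def
    using d by (simp add: Pi_iff cong: SUP_cong)
qed

lemma delta_isometry_isometry_right:
  assumes b: "bij_betw \<phi> (mspace Y) (mspace Y')"
    and d: "\<And>x y. \<lbrakk>x \<in> mspace Y; y \<in> mspace Y\<rbrakk> \<Longrightarrow> mdist Y' (\<phi> x) (\<phi> y) = mdist Y x y"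
    and i: "i \<in> mspace X \<rightarrow> mspace Y"
  shows "delta_isometry X Y' \<Delta> (\<phi> \<circ> i) \<longleftrightarrow> delta_isometry X Y \<Delta> i"
proof -
  have Y': "mspace Y' = \<phi> ` mspace Y" using b by (simp add: bij_betw_def)
  have i': "\<And>x. x \<in> mspace X \<Longrightarrow> i x \<in> mspace Y" using i by auto
  show ?thesis
    unfolding delta_isometry_def hausdorff_dist_def Y' image_image image_comp comp_def
    using d i' by (simp add: Pi_iff cong: SUP_cong INF_cong)
qed

lemma GH0_dist_isometry_le:
  assumes b: "bij_betw \<phi> (mspace Y) (mspace Y')"
    and d: "\<And>x y. \<lbrakk>x \<in> mspace Y; y \<in> mspace Y\<rbrakk> \<Longrightarrow> mdist Y' (\<phi> x) (\<phi> y) = mdist Y x y"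
    and f: "f \<in> mspace X \<rightarrow> mspace X"
    and g: "g \<in> mspace Y \<rightarrow> mspace Y"
    and g': "\<And>y. y \<in> mspace Y \<Longrightarrow> g' (\<phi> y) = \<phi> (g y)"
  shows "GH0_dist X f Y' g' \<le> GH0_dist X f Y g"
  unfolding GH0_dist_def
proof (rule Inf_superset_mono, rule subsetI)
  fix D assume "D \<in> {ennreal \<Delta> | \<Delta>. \<Delta> > 0 \<and>
     (\<exists>i j. delta_isometry X Y \<Delta> i \<and> delta_isometry Y X \<Delta> j \<and>
        C0_dist (mspace X) Y (g \<circ> i) (i \<circ> f) < ennreal \<Delta> \<and>
        C0_dist (mspace Y) X (j \<circ> g) (f \<circ> j) < ennreal \<Delta>)}"
  then obtain \<Delta> i j where D: "D = ennreal \<Delta>" "\<Delta> > 0"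
      and i: "delta_isometry X Y \<Delta> i" and j: "delta_isometry Y X \<Delta> j"
      and ci: "C0_dist (mspace X) Y (g \<circ> i) (i \<circ> f) < ennreal \<Delta>"
      and cj: "C0_dist (mspace Y) X (j \<circ> g) (f \<circ> j) < ennreal \<Delta>"
    by blast
  define \<theta> where "\<theta> = the_inv_into (mspace Y) \<phi>"
  have \<theta>: "\<And>x. x \<in> mspace Y \<Longrightarrow> \<theta> (\<phi> x) = x"
    using b by (simp add: \<theta>_def the_inv_into_f_f bij_betw_def)
  have Y': "mspace Y' = \<phi> ` mspace Y" using b by (simp add: bij_betw_def)
  have iY: "i \<in> mspace X \<rightarrow> mspace Y" using i by (simp add: delta_isometry_def)
  have 1: "delta_isometry X Y' \<Delta> (\<phi> \<circ> i)"
    using delta_isometry_isometry_right[OF b d iY] i by blast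
  have "delta_isometry Y X \<Delta> ((j \<circ> \<theta>) \<circ> \<phi>)"
    using j \<theta> by (simp add: delta_isometry_def Pi_iff cong: SUP_cong image_cong)
  then have 2: "delta_isometry Y' X \<Delta> (j \<circ> \<theta>)"
    using delta_isometry_isometry_left[OF b d] by blast
  have 3: "C0_dist (mspace X) Y' (g' \<circ> (\<phi> \<circ> i)) ((\<phi> \<circ> i) \<circ> f) < ennreal \<Delta>"
  proof -
    have "mdist Y' (g' (\<phi> (i x))) (\<phi> (i (f x))) = mdist Y (g (i x)) (i (f x))"
      if "x \<in> mspace X" for x
      using that f g iY by (simp add: g' d Pi_iff)
    then show ?thesis using ci by (simp add: C0_dist_def cong: SUP_cong)
  qed
  have 4: "C0_dist (mspace Y') X ((j \<circ> \<theta>) \<circ> g') (f \<circ> (j \<circ> \<theta>)) < ennreal \<Delta>"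
  proof -
    have "mdist X (j (\<theta> (g' (\<phi> y)))) (f (j (\<theta> (\<phi> y)))) = mdist X (j (g y)) (f (j y))"
      if "y \<in> mspace Y" for y
      using that g by (simp add: g' \<theta> Pi_iff)
    then show ?thesis using cj unfolding C0_dist_def Y' image_image comp_def by (simp cong: SUP_cong)
  qed
  show "D \<in> {ennreal \<Delta> | \<Delta>. \<Delta> > 0 \<and>
     (\<exists>i j. delta_isometry X Y' \<Delta> i \<and> delta_isometry Y' X \<Delta> j \<and>
        C0_dist (mspace X) Y' (g' \<circ> i) (i \<circ> f) < ennreal \<Delta> \<and>
        C0_dist (mspace Y') X (j \<circ> g') (f \<circ> j) < ennreal \<Delta>)}"
    using D 1 2 3 4 by blast
qed

proposition topologically_GH_stable_any_type:
  fixes X :: "'a metric" and \<epsilon> :: real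
  assumes "topologically_GH_stable X f" and f: "f \<in> mspace X \<rightarrow> mspace X" and "\<epsilon> > 0"
  shows "\<exists>\<eta>>0. \<forall>(Y :: 'b metric) g.
        compact_space (mtopology_of Y) \<longrightarrow>
        homeomorphic_map (mtopology_of Y) (mtopology_of Y) g \<longrightarrow>
        GH0_dist X f Y g < ennreal \<eta> \<longrightarrow>
        (\<exists>h. continuous_map (mtopology_of Y) (mtopology_of X) h \<and>
             delta_isometry Y X \<epsilon> h \<and>
             (\<forall>y\<in>mspace Y. f (h y) = h (g y)))"
proof -
  obtain \<eta> where "\<eta> > 0" and \<eta>: "\<And>(Y :: real metric) g.
        \<lbrakk>compact_space (mtopology_of Y); homeomorphic_map (mtopology_of Y) (mtopology_of Y) g;
         GH0_dist X f Y g < ennreal \<eta>\<rbrakk> \<Longrightarrow>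
        (\<exists>h. continuous_map (mtopology_of Y) (mtopology_of X) h \<and>
             delta_isometry Y X \<epsilon> h \<and> (\<forall>y\<in>mspace Y. f (h y) = h (g y)))"
    using assms(1) \<open>\<epsilon> > 0\<close> unfolding topologically_GH_stable_def by metis
  show ?thesis
  proof (intro exI[of _ \<eta>] conjI \<open>\<eta> > 0\<close> allI impI)
    fix Y :: "'b metric" and g
    assume Y: "compact_space (mtopology_of Y)"
      and g: "homeomorphic_map (mtopology_of Y) (mtopology_of Y) g"
      and D: "GH0_dist X f Y g < ennreal \<eta>"
    obtain Y' :: "real metric" and \<phi> :: "'b \<Rightarrow> real" where
      hom: "homeomorphic_map (mtopology_of Y) (mtopology_of Y') \<phi>" and
      b: "bij_betw \<phi> (mspace Y) (mspace Y')" and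
      d: "\<And>x y. \<lbrakk>x \<in> mspace Y; y \<in> mspace Y\<rbrakk> \<Longrightarrow> mdist Y' (\<phi> x) (\<phi> y) = mdist Y x y"
      using compact_metric_isometric_real[OF Y] by metis
    obtain \<theta> where \<theta>: "homeomorphic_maps (mtopology_of Y) (mtopology_of Y') \<phi> \<theta>"
      using hom homeomorphic_map_maps by blast
    then have \<theta>\<phi>: "\<And>y. y \<in> mspace Y \<Longrightarrow> \<theta> (\<phi> y) = y"
      by (simp add: homeomorphic_maps_def)
    have h\<theta>: "homeomorphic_map (mtopology_of Y') (mtopology_of Y) \<theta>"
      using \<theta> homeomorphic_map_maps homeomorphic_maps_sym by blast
    define g' where "g' = \<phi> \<circ> g \<circ> \<theta>"
    have gY: "g \<in> mspace Y \<rightarrow> mspace Y"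
      using homeomorphic_imp_continuous_map[OF g] continuous_map_funspace by fastforce
    have Y'c: "compact_space (mtopology_of Y')"
      using hom Y homeomorphic_compact_space homeomorphic_map_imp_homeomorphic_space by blast
    have g'h: "homeomorphic_map (mtopology_of Y') (mtopology_of Y') g'"
      unfolding g'_def
      by (intro homeomorphic_map_compose[OF h\<theta>] homeomorphic_map_compose[OF g hom])
    have g'\<phi>: "\<And>y. y \<in> mspace Y \<Longrightarrow> g' (\<phi> y) = \<phi> (g y)"
      by (simp add: g'_def \<theta>\<phi>)
    have "GH0_dist X f Y' g' < ennreal \<eta>"
      using GH0_dist_isometry_le[OF b d f gY g'\<phi>] D by (meson order.strict_trans1)
    then obtain h where h: "continuous_map (mtopology_of Y') (mtopology_of X) h"
        "delta_isometry Y' X \<epsilon> h" "\<forall>y\<in>mspace Y'. f (h y) = h (g' y)"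
      using \<eta>[OF Y'c g'h] by blast
    show "\<exists>h. continuous_map (mtopology_of Y) (mtopology_of X) h \<and>
             delta_isometry Y X \<epsilon> h \<and> (\<forall>y\<in>mspace Y. f (h y) = h (g y))"
    proof (intro exI[of _ "h \<circ> \<phi>"] conjI ballI)
      show "continuous_map (mtopology_of Y) (mtopology_of X) (h \<circ> \<phi>)"
        using h(1) hom continuous_map_compose homeomorphic_imp_continuous_map by blast
      show "delta_isometry Y X \<epsilon> (h \<circ> \<phi>)"
        using h(2) delta_isometry_isometry_left[OF b d] by blast
      show "f ((h \<circ> \<phi>) y) = (h \<circ> \<phi>) (g y)" if "y \<in> mspace Y" for y
        using h(3) that g'\<phi> bij_betwE[OF b] by fastforce
    qed
  qed
qed

section \<open>Well-definedness of the entropy\<close>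

lemma bdd_above_card_separated:
  fixes X :: "'a metric"
  assumes X: "compact_space (mtopology_of X)"
    and f: "continuous_map (mtopology_of X) (mtopology_of X) f" and "\<delta> > 0" "n > 0"
  shows "bdd_above (card ` {E. separated_set X f n \<delta> E})"
proof -
  interpret M: Metric_space "mspace X" "mdist X" by auto
  have fn: "continuous_map (mtopology_of X) (mtopology_of X) (f ^^ j)" for j
  proof (induction j)
    case (Suc j)
    show ?case unfolding funpow.simps by (rule continuous_map_compose[OF Suc f])
  qed simp
  have fX: "(f ^^ j) x \<in> mspace X" if "x \<in> mspace X" for j x
    using fn[of j] that continuous_map_image_subset_topspace by fastforce
  define U where "U x = (\<Inter>j<n. {y \<in> mspace X. (f ^^ j) y \<in> M.mball ((f ^^ j) x) (\<delta> / 2)})" for x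
  have U: "openin (mtopology_of X) (U x)" for x
  proof -
    have "openin (mtopology_of X) {y \<in> mspace X. (f ^^ j) y \<in> M.mball ((f ^^ j) x) (\<delta> / 2)}" for j
      using openin_continuous_map_preimage[OF fn[of j], of "M.mball ((f ^^ j) x) (\<delta> / 2)"]
      by (simp add: mtopology_of_def M.openin_mball)
    then show ?thesis
      unfolding U_def using \<open>n > 0\<close> by (intro openin_Inter) auto
  qed
  have self: "x \<in> U x" if "x \<in> mspace X" for x
    using that fX \<open>\<delta> > 0\<close> by (auto simp: U_def)
  obtain F where F: "finite F" "F \<subseteq> U ` mspace X" "mspace X \<subseteq> \<Union>F"
    using X U self unfolding compact_space_alt
    by (smt (verit, ccfv_threshold) UN_I imageE subsetI topspace_mtopology_of)
  have "card E \<le> card F" if E: "separated_set X f n \<delta> E" for E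
  proof -
    have "\<forall>x\<in>E. \<exists>u. u \<in> F \<and> x \<in> u"
      using E F(3) by (auto simp: separated_set_def)
    then obtain c where c: "\<And>x. x \<in> E \<Longrightarrow> c x \<in> F \<and> x \<in> c x"
      by metis
    have "inj_on c E"
    proof (rule inj_onI, rule ccontr)
      fix x y assume xy: "x \<in> E" "y \<in> E" "c x = c y" "x \<noteq> y"
      then obtain z where z: "z \<in> mspace X" "x \<in> U z" "y \<in> U z"
        using c[of x] c[of y] F(2) by auto
      have "mdist X ((f ^^ j) x) ((f ^^ j) y) < \<delta>" if j: "j < n" for j
      proof -
        have "mdist X ((f ^^ j) z) ((f ^^ j) x) < \<delta> / 2" "mdist X ((f ^^ j) z) ((f ^^ j) y) < \<delta> / 2"
          "x \<in> mspace X" "y \<in> mspace X"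
          using z j by (auto simp: U_def)
        then show ?thesis
          using M.triangle[of "(f ^^ j) x" "(f ^^ j) z" "(f ^^ j) y"] fX z(1)
            M.commute[of "(f ^^ j) x" "(f ^^ j) z"] by simp
      qed
      then have "(MAX j\<in>{..<n}. mdist X ((f ^^ j) x) ((f ^^ j) y)) < \<delta>"
        using \<open>n > 0\<close> by (subst Max_less_iff) auto
      then show False using E xy unfolding separated_set_def by fastforce
    qed
    then show ?thesis using c F(1) by (meson card_inj_on_le image_subsetI)
  qed
  then show ?thesis by (intro bdd_aboveI[of _ "card F"]) auto
qed

lemma tendsto_at_right_SUP_antimono:
  fixes F :: "real \<Rightarrow> ereal"
  assumes "\<And>a b. \<lbrakk>0 < a; a \<le> b\<rbrakk> \<Longrightarrow> F b \<le> F a"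
  shows "(F \<longlongrightarrow> (SUP \<delta>\<in>{0<..}. F \<delta>)) (at_right 0)"
proof (rule order_tendstoI)
  fix a assume "a < (SUP \<delta>\<in>{0<..}. F \<delta>)"
  then obtain e where "e > 0" "a < F e" by (auto simp: less_SUP_iff)
  then show "eventually (\<lambda>x. a < F x) (at_right 0)"
    unfolding eventually_at_right_field using assms
    by (metis order.strict_trans2 order_less_imp_le)
next
  fix a assume "(SUP \<delta>\<in>{0<..}. F \<delta>) < a"
  then have "F x < a" if "x > 0" for x
    using that by (meson SUP_upper greaterThan_iff order.strict_trans1)
  then show "eventually (\<lambda>x. F x < a) (at_right 0)"
    by (simp add: eventually_at_right_less eventually_mono[OF eventually_at_right_less])
qed

proposition topological_entropy_limit:
  fixes X :: "'a metric"
  assumes X: "compact_space (mtopology_of X)"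
    and f: "continuous_map (mtopology_of X) (mtopology_of X) f"
  shows "((\<lambda>\<delta>. limsup (\<lambda>n. ereal (1 / real n * ln (real (max_separated X f n \<delta>)))))
           \<longlongrightarrow> topological_entropy X f) (at_right 0)"
proof -
  let ?F = "\<lambda>\<delta>. limsup (\<lambda>n. ereal (1 / real n * ln (real (max_separated X f n \<delta>))))"
  have mono: "?F b \<le> ?F a" if ab: "0 < a" "a \<le> b" for a b
  proof (rule Limsup_mono, rule eventually_mono[OF eventually_gt_at_top[of 0]])
    fix n :: nat assume n: "n > 0"
    have "max_separated X f n b \<le> max_separated X f n a"
      unfolding max_separated_def
    proof (rule cSUP_subset_mono)
      have "separated_set X f n b {}" by (simp add: separated_set_def)
      then show "{E. separated_set X f n b E} \<noteq> {}" by blast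
      show "bdd_above (card ` {E. separated_set X f n a E})"
        using bdd_above_card_separated[OF X f ab(1) n] .
      show "{E. separated_set X f n b E} \<subseteq> {E. separated_set X f n a E}"
        using ab(2) by (force simp: separated_set_def)
    qed simp
    then have "ln (real (max_separated X f n b)) \<le> ln (real (max_separated X f n a))"
      by (cases "max_separated X f n b = 0"; cases "max_separated X f n a = 0") auto
    then show "ereal (1 / real n * ln (real (max_separated X f n b)))
               \<le> ereal (1 / real n * ln (real (max_separated X f n a)))"
      by (simp add: divide_right_mono)
  qed
  have "(?F \<longlongrightarrow> (SUP \<delta>\<in>{0<..}. ?F \<delta>)) (at_right 0)"
    by (rule tendsto_at_right_SUP_antimono) (rule mono)
  moreover from this have "topological_entropy X f = (SUP \<delta>\<in>{0<..}. ?F \<delta>)"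
    unfolding topological_entropy_def by (intro tendsto_Lim) auto
  ultimately show ?thesis by simp
qed

end

theory Submission
  imports Defs
begin

text \<open>Let \<open>x\<close> have a dense positive orbit. Approximating \<open>f\<^sup>-\<^sup>1 x\<close> by points of that orbit shows
  that \<open>x\<close> returns arbitrarily close to itself, so there is a finite segment
  \<open>x, f x, \<dots>, f\<^sup>N\<^sup>-\<^sup>1 x\<close> of distinct points which is a fine net of \<open>X\<close> and for which \<open>f\<^sup>N x\<close> is
  close to \<open>x\<close> (the whole orbit, if \<open>x\<close> is periodic). The cyclic permutation of this segment is
  close to \<open>f\<close> in the \<open>C\<^sup>0\<close>-Gromov--Hausdorff distance, by way of the nearest point map and the
  inclusion, and as a map of a finite space it has entropy 0.\<close>

section \<open>Finite metric spaces: discrete topology and zero entropy\<close>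

lemma mtopology_of_finite:
  assumes "finite (mspace Y)"
  shows "mtopology_of Y = discrete_topology (mspace Y)"
proof -
  interpret M: Metric_space "mspace Y" "mdist Y" by auto
  show ?thesis
    using assms M.Hausdorff_space_mtopology
    by (intro finite_topspace_imp_discrete_topology) (auto simp: mtopology_of_def)
qed

lemma homeomorphic_map_discrete_topology:
  assumes "bij_betw g A B"
  shows "homeomorphic_map (discrete_topology A) (discrete_topology B) g"
  using assms
  by (intro bijective_open_imp_homeomorphic_map) (auto simp: bij_betw_def open_map_def)

text \<open>The largest cardinality of a separated set lies between 1 and
  \<open>card (mspace Y)\<close> for all \<open>n\<close> and \<open>\<delta>\<close>, so its
  logarithm is bounded and the factor \<open>1 / real n\<close> sends it to 0. The upper limit is
  therefore 0 at every scale, before \<open>\<delta>\<close> tends to 0.\<close>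

lemma topological_entropy_finite:
  assumes fin: "finite (mspace Y)" and "mspace Y \<noteq> {}"
  shows "topological_entropy Y g = 0"
proof -
  obtain y where y: "y \<in> mspace Y" using assms by blast
  have lim: "(\<lambda>n. ereal (1 / real n * ln (real (max_separated Y g n \<delta>)))) \<longlonglongrightarrow> 0" for \<delta>
  proof -
    let ?m = "\<lambda>n. max_separated Y g n \<delta>"
    have m: "1 \<le> ?m n" "?m n \<le> card (mspace Y)" for n
    proof -
      have le: "card E \<le> card (mspace Y)" if "separated_set Y g n \<delta> E" for E
        using that fin by (auto simp: separated_set_def intro: card_mono)
      \<comment> \<open>A singleton is separated vacuously, whatever \<open>n\<close> and
        \<open>\<delta>\<close> are; this keeps the logarithm nonnegative.\<close>
      have y': "separated_set Y g n \<delta> {y}"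
        using y by (simp add: separated_set_def)
      have "card {y} \<le> ?m n"
        unfolding max_separated_def using y' le
        by (intro cSUP_upper bdd_aboveI[of _ "card (mspace Y)"]) auto
      then show "1 \<le> ?m n" by simp
      show "?m n \<le> card (mspace Y)"
        unfolding max_separated_def using y' le by (intro cSUP_least) auto
    qed
    have "(\<lambda>n. 1 / real n * ln (real (?m n))) \<longlonglongrightarrow> 0"
    proof (rule tendsto_sandwich[OF _ _ tendsto_const])
      have m': "1 \<le> real (?m n)" "real (?m n) \<le> real (card (mspace Y))" for n
        using m[of n] by linarith+
      show "\<forall>\<^sub>F n in sequentially. 0 \<le> 1 / real n * ln (real (?m n))"
        using m' by simp
      have "1 / real n * ln (real (?m n)) \<le> 1 / real n * ln (real (card (mspace Y)))" for n
        using m'[of n] by (intro mult_left_mono) auto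
      then show "\<forall>\<^sub>F n in sequentially.
          1 / real n * ln (real (?m n)) \<le> 1 / real n * ln (real (card (mspace Y)))"
        by simp
      show "(\<lambda>n. 1 / real n * ln (real (card (mspace Y)))) \<longlonglongrightarrow> 0"
        using lim_1_over_n by (rule tendsto_mult_left_zero)
    qed
    then show ?thesis by (simp add: zero_ereal_def)
  qed
  have "limsup (\<lambda>n. ereal (1 / real n * ln (real (max_separated Y g n \<delta>)))) = 0" for \<delta>
    using lim by (intro lim_imp_Limsup) auto
  then show ?thesis
    unfolding topological_entropy_def by (simp add: tendsto_Lim)
qed

section \<open>From pointwise estimates to the Gromov-Hausdorff distance\<close>

text \<open>Strict pointwise bounds may become equalities in the supremum; the gap between
  \<open>c\<close> and \<open>d\<close> keeps the final inequality strict. From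
  \<open>0 \<le> c\<close> it follows that \<open>d\<close> is positive, so the inequality survives
  \<open>ennreal\<close>, which maps negative reals to 0.\<close>

lemma SUP_ennreal_less:
  assumes "\<And>x. x \<in> A \<Longrightarrow> h x \<le> ennreal c" and "0 \<le> c" and "c < d"
  shows "(SUP x\<in>A. h x) < ennreal d"
  using assms by (meson SUP_least ennreal_lessI order.strict_trans1 order.strict_trans2)

lemma hausdorff_dist_less:
  assumes "\<And>a. a \<in> A \<Longrightarrow> \<exists>b\<in>B. mdist X a b \<le> c" and "\<And>b. b \<in> B \<Longrightarrow> \<exists>a\<in>A. mdist X a b \<le> c"
    and "0 \<le> c" and "c < d"
  shows "hausdorff_dist X A B < ennreal d"
  unfolding hausdorff_dist_def max_less_iff_conj
proof (intro conjI SUP_ennreal_less[OF _ assms(3,4)])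
  show "(INF b\<in>B. ennreal (mdist X a b)) \<le> ennreal c" if "a \<in> A" for a
    using assms(1)[OF that] by (meson INF_lower2 ennreal_leI)
  show "(INF a\<in>A. ennreal (mdist X a b)) \<le> ennreal c" if "b \<in> B" for b
    using assms(2)[OF that] by (meson INF_lower2 ennreal_leI)
qed

text \<open>Only one half of the Hausdorff distance needs a bound: the image lies in
  \<open>mspace Y\<close>, so the other half is 0.\<close>

lemma delta_isometryI:
  assumes "i \<in> mspace X \<rightarrow> mspace Y"
    and "\<And>y. y \<in> mspace Y \<Longrightarrow> \<exists>x\<in>mspace X. mdist Y (i x) y \<le> c"
    and "\<And>x x'. \<lbrakk>x \<in> mspace X; x' \<in> mspace X\<rbrakk> \<Longrightarrow> \<bar>mdist Y (i x) (i x') - mdist X x x'\<bar> \<le> c"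
    and "0 \<le> c" and "c < \<Delta>"
  shows "delta_isometry X Y \<Delta> i"
  unfolding delta_isometry_def max_less_iff_conj
proof (intro conjI SUP_ennreal_less[OF _ assms(4,5)] SUP_least)
  show "hausdorff_dist Y (i ` mspace X) (mspace Y) < ennreal \<Delta>"
  proof (rule hausdorff_dist_less[OF _ _ assms(4,5)])
    show "\<exists>b\<in>mspace Y. mdist Y a b \<le> c" if "a \<in> i ` mspace X" for a
      using that assms(1,4) by (intro bexI[of _ a]) (auto simp: Pi_iff Metric_space.mdist_zero[OF Metric_space_mspace_mdist])
  qed (use assms(2) in auto)
qed (use assms in \<open>auto intro: ennreal_leI\<close>)

text \<open>The two isometries are a map \<open>i\<close> into \<open>Y\<close> moving each point by
  less than \<open>\<eta>\<close>, and the inclusion of \<open>Y\<close>. The former distorts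
  distances by less than \<open>2 * \<eta>\<close>. Passing from \<open>g (i x)\<close> to
  \<open>i (f x)\<close> through \<open>f (i x)\<close> and \<open>f x\<close> costs
  \<open>\<eta>\<close>, \<open>\<epsilon>\<close> and \<open>\<eta>\<close>, whence the constant
  \<open>2 * \<eta> + \<epsilon>\<close>.\<close>

lemma GH0_dist_subspace_less:
  assumes f: "f \<in> mspace X \<rightarrow> mspace X" and YX: "Y \<subseteq> mspace X" and g: "g \<in> Y \<rightarrow> Y"
    and net: "\<And>x. x \<in> mspace X \<Longrightarrow> \<exists>y\<in>Y. mdist X x y < \<eta>"
    and gf: "\<And>y. y \<in> Y \<Longrightarrow> mdist X (g y) (f y) < \<eta>"
    and modulus: "\<And>a b. \<lbrakk>a \<in> mspace X; b \<in> mspace X; mdist X a b < \<eta>\<rbrakk> \<Longrightarrow> mdist X (f a) (f b) < \<epsilon>"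
    and pos: "\<eta> > 0" "\<epsilon> > 0" and \<Delta>: "2 * \<eta> + \<epsilon> < \<Delta>"
  shows "GH0_dist X f (submetric X Y) g < ennreal \<Delta>"
proof -
  interpret M: Metric_space "mspace X" "mdist X" by auto
  let ?c = "2 * \<eta> + \<epsilon>"
  have [simp]: "Y \<inter> mspace X = Y" using YX by blast
  obtain i where i: "\<And>x. x \<in> mspace X \<Longrightarrow> i x \<in> Y" "\<And>x. x \<in> mspace X \<Longrightarrow> mdist X x (i x) < \<eta>"
    using net by metis
  \<comment> \<open>The infimum has to be strictly below \<open>\<Delta>\<close>, so an admissible
    \<open>\<Delta>'\<close> smaller than \<open>\<Delta>\<close> is exhibited;
    \<open>?c < \<Delta>'\<close> leaves room for the suprema.\<close>
  obtain \<Delta>' where \<Delta>': "?c < \<Delta>'" "\<Delta>' < \<Delta>" using \<Delta> dense by blast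
  have iX: "\<And>x. x \<in> mspace X \<Longrightarrow> i x \<in> mspace X" using i YX by auto
  have fX: "\<And>x. x \<in> mspace X \<Longrightarrow> f x \<in> mspace X" using f by auto
  have gX: "\<And>y. y \<in> Y \<Longrightarrow> g y \<in> mspace X" using g YX by auto
  have 1: "delta_isometry X (submetric X Y) \<Delta>' i"
  proof (rule delta_isometryI[OF _ _ _ _ \<Delta>'(1)])
    show "\<exists>x\<in>mspace X. mdist (submetric X Y) (i x) y \<le> ?c" if "y \<in> mspace (submetric X Y)" for y
      using that YX i(2)[of y] pos M.commute[of y "i y"] by (intro bexI[of _ y]) auto
    show "\<bar>mdist (submetric X Y) (i x) (i x') - mdist X x x'\<bar> \<le> ?c"
      if "x \<in> mspace X" "x' \<in> mspace X" for x x'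
      using M.triangle[of "i x" x "i x'"] M.triangle[of x x' "i x'"] M.triangle[of x "i x" x']
        M.triangle[of "i x" "i x'" x'] i(2)[of x] i(2)[of x'] that iX pos
        M.commute[of x "i x"] M.commute[of x' "i x'"] by simp
  qed (use i pos in auto)
  have 2: "delta_isometry (submetric X Y) X \<Delta>' id"
  proof (rule delta_isometryI[OF _ _ _ _ \<Delta>'(1)])
    show "\<exists>y\<in>mspace (submetric X Y). mdist X (id y) x \<le> ?c" if "x \<in> mspace X" for x
      using that i[of x] pos M.commute[of x "i x"] by (intro bexI[of _ "i x"]) auto
  qed (use YX pos in auto)
  have 3: "C0_dist (mspace X) (submetric X Y) (g \<circ> i) (i \<circ> f) < ennreal \<Delta>'"
    unfolding C0_dist_def
  proof (rule SUP_ennreal_less[OF _ _ \<Delta>'(1)])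
    fix x assume x: "x \<in> mspace X"
    have "mdist X (f (i x)) (f x) < \<epsilon>"
      using modulus[of "i x" x] i(2)[OF x] iX x by (simp add: M.commute)
    then have "mdist X (g (i x)) (i (f x)) \<le> ?c"
      using M.triangle[of "g (i x)" "f (i x)" "i (f x)"] M.triangle[of "f (i x)" "f x" "i (f x)"]
        gf[OF i(1)[OF x]] i(2)[OF fX[OF x]] x fX iX gX i(1) by simp
    then show "ennreal (mdist (submetric X Y) ((g \<circ> i) x) ((i \<circ> f) x)) \<le> ennreal ?c"
      by (simp add: ennreal_leI)
  qed (use pos in simp)
  have 4: "C0_dist (mspace (submetric X Y)) X (id \<circ> g) (f \<circ> id) < ennreal \<Delta>'"
    unfolding C0_dist_def
  proof (rule SUP_ennreal_less[OF _ _ \<Delta>'(1)])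
    show "ennreal (mdist X ((id \<circ> g) y) ((f \<circ> id) y)) \<le> ennreal ?c"
      if "y \<in> mspace (submetric X Y)" for y
      using gf[of y] that pos by (intro ennreal_leI) auto
  qed (use pos in simp)
  have "ennreal \<Delta>' < ennreal \<Delta>" and "0 < \<Delta>'"
    using \<Delta>' pos by (auto intro: ennreal_lessI)
  then show ?thesis
    unfolding GH0_dist_def Inf_less_iff using 1 2 3 4 by blast
qed

section \<open>Dense orbits that almost close up\<close>

lemma transitive_dense_orbit:
  assumes "topologically_transitive X f"
  obtains x where "x \<in> mspace X"
    "\<And>z r. \<lbrakk>z \<in> mspace X; 0 < r\<rbrakk> \<Longrightarrow> \<exists>n. mdist X z ((f ^^ n) x) < r"
proof -
  interpret M: Metric_space "mspace X" "mdist X" by auto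
  obtain x where "x \<in> mspace X" "mtopology_of X closure_of (range (\<lambda>n. (f ^^ n) x)) = mspace X"
    using assms unfolding topologically_transitive_def by blast
  then show thesis
    using that[of x] unfolding mtopology_of_def M.metric_closure_of by force
qed

text \<open>Total boundedness gives finitely many centres at scale \<open>\<eta> / 2\<close>. Each
  centre is replaced by a term of the sequence within \<open>\<eta> / 2\<close> of it, and
  \<open>M\<close> exceeds the finitely many indices used.\<close>

lemma compact_dense_sequence_finite_net:
  assumes X: "compact_space (mtopology_of X)"
    and dense: "\<And>z r. \<lbrakk>z \<in> mspace X; 0 < r\<rbrakk> \<Longrightarrow> \<exists>n. mdist X z (u n) < r"
    and u: "\<And>n. u n \<in> mspace X" and "\<eta> > 0"
  obtains M :: nat where "\<And>z. z \<in> mspace X \<Longrightarrow> \<exists>n<M. mdist X z (u n) < \<eta>"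
proof -
  interpret M: Metric_space "mspace X" "mdist X" by auto
  have "M.mtotally_bounded (mspace X)"
    using X M.compact_space_eq_mcomplete_mtotally_bounded by (simp add: mtopology_of_def)
  then obtain K where K: "finite K" "K \<subseteq> mspace X" "mspace X \<subseteq> (\<Union>k\<in>K. M.mball k (\<eta> / 2))"
    unfolding M.mtotally_bounded_def using \<open>\<eta> > 0\<close> by (meson half_gt_zero)
  obtain n where n: "\<And>k. k \<in> K \<Longrightarrow> mdist X k (u (n k)) < \<eta> / 2"
  proof -
    have "\<forall>k\<in>K. \<exists>n. mdist X k (u n) < \<eta> / 2"
      using dense[OF subsetD[OF K(2)] half_gt_zero[OF \<open>\<eta> > 0\<close>]] by blast
    then show thesis using that by metis
  qed
  show thesis
  proof (rule that)
    fix z assume z: "z \<in> mspace X"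
    then obtain k where k: "k \<in> K" "mdist X k z < \<eta> / 2" using K(3) by auto
    have "mdist X z (u (n k)) < \<eta>"
      using M.triangle[of z k "u (n k)"] M.commute[of k z] n[OF k(1)] k K(2) z u by auto
    moreover have "n k < Suc (Max (n ` K))"
      using K(1) k(1) by (simp add: less_Suc_eq_le)
    ultimately show "\<exists>i<Suc (Max (n ` K)). mdist X z (u i) < \<eta>" by blast
  qed
qed

text \<open>If two iterates coincide, injectivity cancels the smaller exponent and leaves a return
  to \<open>x\<close> at a positive time below \<open>N\<close>.\<close>

lemma inj_on_funpow_no_return:
  assumes f: "f \<in> S \<rightarrow> S" "inj_on f S" and x: "x \<in> S"
    and nr: "\<And>k. \<lbrakk>0 < k; k < N\<rbrakk> \<Longrightarrow> (f ^^ k) x \<noteq> x"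
  shows "inj_on (\<lambda>n. (f ^^ n) x) {..<N}"
proof -
  have S: "(f ^^ n) x \<in> S" for n
    using f(1) x by (induction n) auto
  have cancel: "(f ^^ (i + k)) x = (f ^^ i) x \<Longrightarrow> (f ^^ k) x = x" for i k
    using inj_onD[OF f(2)] S by (induction i) auto
  have False if "i < j" "j < N" "(f ^^ i) x = (f ^^ j) x" for i j
    using cancel[of i "j - i"] nr[of "j - i"] that by simp
  then show ?thesis
    by (intro linorder_inj_onI) auto
qed

text \<open>The Heine-Cantor theorem, in the form of a modulus of continuity.\<close>

lemma continuous_map_compact_modulus:
  assumes "compact_space (mtopology_of X)"
    and "continuous_map (mtopology_of X) (mtopology_of Z) f" and "\<epsilon> > 0"
  obtains \<kappa> where "\<kappa> > 0"
    "\<And>a b. \<lbrakk>a \<in> mspace X; b \<in> mspace X; mdist X a b < \<kappa>\<rbrakk> \<Longrightarrow> mdist Z (f a) (f b) < \<epsilon>"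
proof -
  have "uniformly_continuous_map X Z f"
    using assms(1,2) continuous_eq_uniformly_continuous_map by blast
  then show thesis
    using that \<open>\<epsilon> > 0\<close> unfolding uniformly_continuous_map_def by blast
qed

lemma transitive_closing_segment:
  assumes X: "compact_space (mtopology_of X)"
    and f: "homeomorphic_map (mtopology_of X) (mtopology_of X) f"
    and trans: "topologically_transitive X f" and \<eta>: "\<eta> > 0"
  obtains x N where "x \<in> mspace X" "0 < N" "inj_on (\<lambda>n. (f ^^ n) x) {..<N}"
    "\<And>z. z \<in> mspace X \<Longrightarrow> \<exists>n<N. mdist X z ((f ^^ n) x) < \<eta>"
    "mdist X x ((f ^^ N) x) < \<eta>"
proof -
  interpret M: Metric_space "mspace X" "mdist X" by auto
  have fS: "f ` mspace X = mspace X" and inj: "inj_on f (mspace X)"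
    using f homeomorphic_imp_surjective_map homeomorphic_imp_injective_map by fastforce+
  then have fX: "f \<in> mspace X \<rightarrow> mspace X" by blast
  obtain x where x: "x \<in> mspace X"
    and dense: "\<And>z r. \<lbrakk>z \<in> mspace X; 0 < r\<rbrakk> \<Longrightarrow> \<exists>n. mdist X z ((f ^^ n) x) < r"
    using transitive_dense_orbit[OF trans] by blast
  have orbX: "(f ^^ n) x \<in> mspace X" for n
    using fX x by (induction n) auto
  obtain M where M: "\<And>z. z \<in> mspace X \<Longrightarrow> \<exists>n<M. mdist X z ((f ^^ n) x) < \<eta>"
    using compact_dense_sequence_finite_net[OF X dense orbX \<eta>] by blast
  \<comment> \<open>Density at \<open>x\<close> itself says nothing, as the orbit contains
    \<open>x\<close> at time 0. Density at the preimage \<open>w\<close> of \<open>x\<close> gives a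
    time \<open>n\<close>, possibly 0, and one more application of \<open>f\<close> makes it the
    positive time \<open>Suc n\<close>.\<close>
  have recurrent: "\<exists>n>0. mdist X x ((f ^^ n) x) < r" if r: "r > 0" for r
  proof -
    obtain w where w: "w \<in> mspace X" "f w = x"
      using x fS by (metis imageE)
    obtain \<kappa> where \<kappa>: "\<kappa> > 0"
      "\<And>a b. \<lbrakk>a \<in> mspace X; b \<in> mspace X; mdist X a b < \<kappa>\<rbrakk> \<Longrightarrow> mdist X (f a) (f b) < r"
      using continuous_map_compact_modulus[OF X homeomorphic_imp_continuous_map[OF f] r] by blast
    obtain n where "mdist X w ((f ^^ n) x) < \<kappa>" using dense[OF w(1) \<kappa>(1)] by blast
    then have "mdist X x ((f ^^ Suc n) x) < r" using \<kappa>(2)[OF w(1) orbX] w(2) by simp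
    then show ?thesis by blast
  qed
  show thesis
  proof (cases "\<exists>k>0. (f ^^ k) x = x")
    case True
    \<comment> \<open>The minimal period makes the iterates distinct. Reducing exponents modulo
      \<open>N\<close> carries the net over to the segment, even when \<open>N\<close> is smaller
      than \<open>M\<close>.\<close>
    define N where "N = (LEAST k. 0 < k \<and> (f ^^ k) x = x)"
    have N: "0 < N" "(f ^^ N) x = x"
      using LeastI_ex[of "\<lambda>k. 0 < k \<and> (f ^^ k) x = x"] True by (auto simp: N_def)
    have nr: "(f ^^ k) x \<noteq> x" if "0 < k" "k < N" for k
      using not_less_Least[of k "\<lambda>k. 0 < k \<and> (f ^^ k) x = x"] that by (auto simp: N_def)
    have "\<exists>n<N. mdist X z ((f ^^ n) x) < \<eta>" if "z \<in> mspace X" for z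
      using M[OF that] funpow_mod_eq[OF N(2)] mod_less_divisor[OF N(1)] by metis
    then show thesis
      using that[OF x N(1) inj_on_funpow_no_return[OF fX inj x nr]] N(2) x \<eta> by simp
  next
    case False
    \<comment> \<open>Without periodicity, \<open>x\<close> has positive distance from each of its
      iterates. A return closer than all of those at times 1 to \<open>M\<close> must come after
      time \<open>M\<close>, so the segment up to it contains the net; including
      \<open>\<eta>\<close> in the minimum makes the return close enough.\<close>
    define r where "r = Min (insert \<eta> ((\<lambda>k. mdist X x ((f ^^ k) x)) ` {1..M}))"
    have "0 < mdist X x ((f ^^ k) x)" if "k > 0" for k
      using False that M.mdist_pos_less[OF _ x orbX, of k] by metis
    then have "r > 0"
      unfolding r_def using \<eta> by (subst Min_gr_iff) auto
    then obtain N where N: "N > 0" "mdist X x ((f ^^ N) x) < r" using recurrent by blast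
    have "M < N"
    proof (rule ccontr)
      assume "\<not> M < N"
      then have "r \<le> mdist X x ((f ^^ N) x)" unfolding r_def using N(1) by (intro Min_le) auto
      then show False using N(2) by simp
    qed
    then have "\<exists>n<N. mdist X z ((f ^^ n) x) < \<eta>" if "z \<in> mspace X" for z
      using M[OF that] by (meson order.strict_trans)
    moreover have "r \<le> \<eta>" by (simp add: r_def)
    moreover have "inj_on (\<lambda>n. (f ^^ n) x) {..<N}"
      using False by (intro inj_on_funpow_no_return[OF fX inj x]) blast
    ultimately show thesis using that[OF x N(1)] N(2) by simp
  qed
qed

section \<open>The cyclic permutation and the approximating system\<close>

text \<open>\<open>Y\<close> is finite, so an injective self-map of it is bijective. For
  \<open>N = 1\<close> the map \<open>g\<close> fixes the only point \<open>x\<close>.\<close>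

lemma cyclic_permutation_of_segment:
  assumes inj: "inj_on f S" and S: "\<And>n. (f ^^ n) x \<in> S"
    and "0 < N" and seg: "inj_on (\<lambda>n. (f ^^ n) x) {..<N}"
  defines "Y \<equiv> (\<lambda>n. (f ^^ n) x) ` {..<N}"
    and "g \<equiv> (\<lambda>y. if y = (f ^^ (N - 1)) x then x else f y)"
  shows "bij_betw g Y Y"
proof -
  have nr: "(f ^^ Suc n) x \<noteq> x" if "Suc n < N" for n
    using inj_onD[OF seg, of "Suc n" 0] that by auto
  have step: "\<exists>n. Suc n < N \<and> y = (f ^^ n) x" if "y \<in> Y" "y \<noteq> (f ^^ (N - 1)) x" for y
    using that unfolding Y_def by (force simp: less_diff_conv intro: Suc_lessI)
  have "g ` Y \<subseteq> Y"
  proof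
    fix v assume "v \<in> g ` Y"
    then obtain y where y: "y \<in> Y" "v = g y" by blast
    show "v \<in> Y"
    proof (cases "y = (f ^^ (N - 1)) x")
      case True
      then show ?thesis
        using y(2) \<open>0 < N\<close> by (auto simp: g_def Y_def intro: image_eqI[of _ _ 0])
    next
      case False
      then obtain n where "Suc n < N" "y = (f ^^ n) x" using step y(1) by blast
      then show ?thesis
        using y(2) False by (auto simp: g_def Y_def intro: image_eqI[of _ _ "Suc n"])
    qed
  qed
  moreover have "inj_on g Y"
  proof (rule inj_onI)
    fix y z assume yz: "y \<in> Y" "z \<in> Y" "g y = g z"
    \<comment> \<open>The value \<open>x\<close> is taken by \<open>g\<close> at the last point
      alone, since the segment does not return to \<open>x\<close> earlier; at all other points
      \<open>g\<close> is \<open>f\<close>, which is injective.\<close>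
    have ne: "f w \<noteq> x" if "w \<in> Y" "w \<noteq> (f ^^ (N - 1)) x" for w
      using step[OF that] nr by auto
    have "Y \<subseteq> S" using S by (auto simp: Y_def)
    then show "y = z"
      using yz ne[of y] ne[of z] inj_onD[OF inj, of y z] by (auto simp: g_def split: if_splits)
  qed
  moreover have "finite Y" by (simp add: Y_def)
  ultimately show ?thesis by (simp add: bij_betw_def endo_inj_surj)
qed

theorem corollary4p6:
  fixes X :: "'a metric" and f :: "'a \<Rightarrow> 'a" and \<delta> :: real
  assumes "compact_space (mtopology_of X)" and "mspace X \<noteq> {}"
    and "homeomorphic_map (mtopology_of X) (mtopology_of X) f"
    and "topologically_transitive X f"
    and "topologically_GH_stable X f"
    and "\<delta> > 0"
  shows "\<exists>(Y :: real metric) g.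
           compact_space (mtopology_of Y) \<and>
           homeomorphic_map (mtopology_of Y) (mtopology_of Y) g \<and>
           GH0_dist X f Y g < ennreal \<delta> \<and>
           topological_entropy Y g = 0"
proof -
  interpret M: Metric_space "mspace X" "mdist X" by auto
  have fX: "f \<in> mspace X \<rightarrow> mspace X" and inj: "inj_on f (mspace X)"
    using assms(3) homeomorphic_imp_surjective_map homeomorphic_imp_injective_map by fastforce+
  have "\<delta> / 4 > 0" using assms(6) by simp
  then obtain \<kappa> where \<kappa>: "\<kappa> > 0"
    "\<And>a b. \<lbrakk>a \<in> mspace X; b \<in> mspace X; mdist X a b < \<kappa>\<rbrakk> \<Longrightarrow> mdist X (f a) (f b) < \<delta> / 4"
    using continuous_map_compact_modulus[OF assms(1) homeomorphic_imp_continuous_map[OF assms(3)]]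
    by blast
  \<comment> \<open>The bound \<open>\<kappa>\<close> makes the modulus apply at scale
    \<open>\<eta>\<close>, and \<open>\<delta> / 4\<close> gives
    \<open>2 * \<eta> + \<delta> / 4 < \<delta>\<close>.\<close>
  define \<eta> where "\<eta> = min \<kappa> (\<delta> / 4)"
  have \<eta>: "\<eta> > 0" "\<eta> \<le> \<kappa>" "\<eta> \<le> \<delta> / 4" using \<kappa>(1) assms(6) by (auto simp: \<eta>_def)
  obtain x N where x: "x \<in> mspace X" and N: "0 < N"
    and seg: "inj_on (\<lambda>n. (f ^^ n) x) {..<N}"
    and net: "\<And>z. z \<in> mspace X \<Longrightarrow> \<exists>n<N. mdist X z ((f ^^ n) x) < \<eta>"
    and closing: "mdist X x ((f ^^ N) x) < \<eta>"
    using transitive_closing_segment[OF assms(1,3,4) \<eta>(1)] by blast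
  have orbX: "(f ^^ n) x \<in> mspace X" for n
    using fX x by (induction n) auto
  define Y where "Y = (\<lambda>n. (f ^^ n) x) ` {..<N}"
  define g where "g = (\<lambda>y. if y = (f ^^ (N - 1)) x then x else f y)"
  have bij: "bij_betw g Y Y"
    unfolding Y_def g_def using cyclic_permutation_of_segment[OF inj orbX N seg] .
  have YX: "Y \<subseteq> mspace X" and fin: "finite Y" and ne: "Y \<noteq> {}"
    using orbX N by (auto simp: Y_def)
  have gY: "g \<in> Y \<rightarrow> Y" using bij bij_betw_apply by fastforce
  let ?Y = "submetric X Y"
  have mY: "mspace ?Y = Y" using YX by auto
  \<comment> \<open>\<open>g\<close> and \<open>f\<close> can differ only at the last point of the
    segment, where their values are \<open>x\<close> and \<open>(f ^^ N) x\<close>.\<close>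
  have gf: "mdist X (g y) (f y) < \<eta>" if "y \<in> Y" for y
  proof (cases "y = (f ^^ (N - 1)) x")
    case True
    then have "f y = (f ^^ N) x" using N by (cases N) auto
    then show ?thesis using True closing by (simp add: g_def)
  next
    case False
    then show ?thesis using that YX fX \<eta>(1) by (auto simp: g_def Pi_iff)
  qed
  have GH: "GH0_dist X f ?Y g < ennreal \<delta>"
  proof (rule GH0_dist_subspace_less[OF fX YX gY _ gf, where \<epsilon> = "\<delta> / 4"])
    show "\<exists>y\<in>Y. mdist X z y < \<eta>" if "z \<in> mspace X" for z
      using net[OF that] by (auto simp: Y_def)
  qed (use \<eta> \<kappa>(2) assms(6) in auto)
  have "mtopology_of ?Y = discrete_topology Y"
    using mtopology_of_finite[of ?Y] fin mY by simp
  then have "compact_space (mtopology_of ?Y)"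
    using fin by (simp add: compact_space_discrete_topology)
  \<comment> \<open>The points of \<open>?Y\<close> have type \<open>'a\<close>; an isometric copy
    over the reals, with \<open>g\<close> conjugated to \<open>g'\<close>, does not increase the
    distance to \<open>f\<close>.\<close>
  then obtain Y' :: "real metric" and \<phi> where
    \<phi>: "bij_betw \<phi> (mspace ?Y) (mspace Y')"
    and d: "\<And>a b. \<lbrakk>a \<in> mspace ?Y; b \<in> mspace ?Y\<rbrakk> \<Longrightarrow> mdist Y' (\<phi> a) (\<phi> b) = mdist ?Y a b"
    using compact_metric_isometric_real by metis
  define g' where "g' = \<phi> \<circ> g \<circ> inv_into Y \<phi>"
  have \<phi>Y: "bij_betw \<phi> Y (mspace Y')" using \<phi> mY by simp
  have fin': "finite (mspace Y')" and ne': "mspace Y' \<noteq> {}"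
    using \<phi>Y fin ne bij_betw_finite bij_betw_empty1 by (blast, metis bij_betw_def image_is_empty)
  have "bij_betw g' (mspace Y') (mspace Y')"
    unfolding g'_def using bij_betw_trans[OF bij_betw_inv_into[OF \<phi>Y] bij_betw_trans[OF bij \<phi>Y]]
    by (simp add: comp_assoc)
  moreover have "g' (\<phi> y) = \<phi> (g y)" if "y \<in> mspace ?Y" for y
    using that \<phi>Y mY by (simp add: g'_def bij_betw_inv_into_left)
  then have "GH0_dist X f Y' g' \<le> GH0_dist X f ?Y g"
    using GH0_dist_isometry_le[OF \<phi> d fX] gY mY by simp
  ultimately show ?thesis
    using GH topological_entropy_finite[OF fin' ne'] fin'
    by (intro exI[of _ Y'] exI[of _ g'])
      (auto simp: mtopology_of_finite[OF fin'] compact_space_discrete_topology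
        intro: homeomorphic_map_discrete_topology)
qed

end
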